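(* Let $d\ge1$ be the space dimension and $\theta>1$. Let $\alpha\ge1$ and $f_0>0$, and assume that $f_1,f_2:\mathbb{R}^d\to\mathbb{R}$ both satisfy assumptions (H0) and (H1) recalled in the context with these same constants $\alpha$ and $f_0$. Set $$m:=\sup_{y\in\mathbb{R}^d}\frac{|f_1(y)-f_2(y)|}{1+|y|^\alpha}.$$ Then $$|\lambda^*(f_2)-\lambda^*(f_1)|\le\frac{f_0m}{1+f_0m}\max(\lambda^*(f_1),\lambda^*(f_2)).$$
   Context: For $f$ locally Lipschitz continuous and bounded from below on $\mathbb{R}^d$, $\lambda^*(f)$ is the supremum of all $\lambda\in\mathbb{R}$ for which there exists $\phi\in C^2(\mathbb{R}^d)$ with $-\frac12\Delta\phi(y)+\frac1\theta|D\phi(y)|^\theta\le f(y)-\lambda$ for all $y\in\mathbb{R}^d$ (a finite real number). Assumptions (for $\alpha\ge1$): (H0) $f\in W^{1,\infty}_{\mathrm{loc}}(\mathbb{R}^d)$ (i.e. $f$ is locally Lipschitz continuous) is bounded from below and $|Df(y)|\le f_0(1+|y|^{\alpha-1})$ for (almost) all $y\in\mathbb{R}^d$. (H1) $f_0^{-1}(|y|^\alpha+1)\le f(y)\le f_0(|y|^\alpha+1)$ for all $y\in\mathbb{R}^d$. *)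

theory Defs
  imports "HOL-Analysis.Analysis"
begin

text \<open>Throughout, the space \<open>\<real>\<^sup>d\<close> with \<open>d \<ge> 1\<close> is an arbitrary type of class
  \<^class>\<open>euclidean_space\<close>; partial derivatives are taken along the orthonormal \<open>Basis\<close>.\<close>

definition partial_derivative ::
    "'a \<Rightarrow> ('a::euclidean_space \<Rightarrow> real) \<Rightarrow> 'a \<Rightarrow> real" where
  "partial_derivative b f x = frechet_derivative f (at x) b"

definition gradient :: "('a::euclidean_space \<Rightarrow> real) \<Rightarrow> 'a \<Rightarrow> 'a" where
  "gradient f x = (\<Sum>b\<in>Basis. partial_derivative b f x *\<^sub>R b)"

definition laplacian :: "('a::euclidean_space \<Rightarrow> real) \<Rightarrow> 'a \<Rightarrow> real" where
  "laplacian f x = (\<Sum>b\<in>Basis. partial_derivative b (partial_derivative b f) x)"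

definition C1_function :: "('a::euclidean_space \<Rightarrow> real) \<Rightarrow> bool" where
  "C1_function f \<longleftrightarrow> (\<forall>x. f differentiable (at x)) \<and>
     (\<forall>b\<in>Basis. continuous_on UNIV (partial_derivative b f))"

definition C2_function :: "('a::euclidean_space \<Rightarrow> real) \<Rightarrow> bool" where
  "C2_function f \<longleftrightarrow> (\<forall>x. f differentiable (at x)) \<and>
     (\<forall>b\<in>Basis. C1_function (partial_derivative b f))"

text \<open>The supremum is the one of the reals. It is the intended finite number for \<open>\<theta> > 1\<close> and
  locally Lipschitz \<open>f\<close> bounded from below: the set then is nonempty (take \<open>\<phi>\<close> constant) and
  bounded above.\<close>

definition lambda_star :: "real \<Rightarrow> ('a::euclidean_space \<Rightarrow> real) \<Rightarrow> real" where
  "lambda_star \<theta> f = Sup {l. \<exists>\<phi>. C2_function \<phi> \<and>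
     (\<forall>y. - (1/2) * laplacian \<phi> y + (1/\<theta>) * norm (gradient \<phi> y) powr \<theta> \<le> f y - l)}"

text \<open>In \<open>H0\<close>, the library predicate \<^const>\<open>local_lipschitz\<close> for families is applied to the
  one-member family \<open>f\<close>. By Rademacher's theorem, a locally Lipschitz function is differentiable
  almost everywhere and its weak gradient is the pointwise one, so differentiability is no
  additional restriction. For \<open>\<alpha> = 1\<close> the convention \<open>0 powr 0 = 0\<close> only affects the
  bound at the single point \<open>0\<close>, a null set.\<close>

definition H0 :: "real \<Rightarrow> real \<Rightarrow> ('a::euclidean_space \<Rightarrow> real) \<Rightarrow> bool" where
  "H0 \<alpha> f\<^sub>0 f \<longleftrightarrow>
     local_lipschitz {0::real} UNIV (\<lambda>_. f) \<and>
     bdd_below (range f) \<and>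
     (AE y in lebesgue. f differentiable (at y) \<and>
        norm (gradient f y) \<le> f\<^sub>0 * (1 + norm y powr (\<alpha> - 1)))"

definition H1 :: "real \<Rightarrow> real \<Rightarrow> ('a::euclidean_space \<Rightarrow> real) \<Rightarrow> bool" where
  "H1 \<alpha> f\<^sub>0 f \<longleftrightarrow>
     (\<forall>y. inverse f\<^sub>0 * (norm y powr \<alpha> + 1) \<le> f y \<and> f y \<le> f\<^sub>0 * (norm y powr \<alpha> + 1))"

end

theory Submission
  imports Defs
begin

text \<open>Hypothesis \<open>H1\<close> turns the weighted bound on \<open>f\<^sub>1 - f\<^sub>2\<close> into a multiplicative comparison:
  \<open>\<bar>f\<^sub>1 - f\<^sub>2\<bar> \<le> m (1 + \<bar>y\<bar>\<^sup>\<alpha>) \<le> f\<^sub>0 m f\<^sub>1\<close>, hence \<open>f\<^sub>2 \<le> (1 + c) f\<^sub>1\<close> with \<open>c = f\<^sub>0 m\<close>, and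
  symmetrically. Put \<open>k = 1 / (1 + c)\<close>, so \<open>0 < k \<le> 1\<close>. If \<open>\<phi>\<close> is a subsolution for \<open>f\<^sub>2\<close> at
  level \<open>l\<close>, then \<open>k \<phi>\<close> is a subsolution for \<open>k f\<^sub>2 \<le> f\<^sub>1\<close> at level \<open>k l\<close>, because
  \<open>k powr \<theta> \<le> k\<close> makes the scaling favourable in the superlinear gradient term. So
  \<open>\<lambda>\<^sup>*(f\<^sub>1) \<ge> k \<lambda>\<^sup>*(f\<^sub>2)\<close>, that is, \<open>\<lambda>\<^sup>*(f\<^sub>2) - \<lambda>\<^sup>*(f\<^sub>1) \<le> c / (1 + c) \<lambda>\<^sup>*(f\<^sub>2)\<close>
  (lemmas \<open>admissible_scaled\<close> and \<open>lambda_star_scaling\<close>).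

  A supremum of reals only carries this information if the set of levels is bounded above
  (lemma \<open>bdd_above_admissible\<close>), and this is the analytic part of the proof. It is a maximum
  principle with an explosive barrier. On the open cube \<open>(-1, 1)\<^sup>d\<close> subtract from \<open>\<phi>\<close> the
  separable function \<open>\<Sum>\<^sub>i g (y\<^sub>i)\<close>, where \<open>g t\<close> is a negative power of \<open>1 - t\<^sup>2\<close>. The
  difference tends to \<open>-\<infinity>\<close> at the boundary and so has an interior maximum, where
  \<open>\<partial>\<^sub>i \<phi> = g' (y\<^sub>i)\<close> and \<open>\<partial>\<^sub>i \<partial>\<^sub>i \<phi> \<le> g'' (y\<^sub>i)\<close>. Since \<open>\<theta> > 1\<close>, for a high enough power
  \<open>\<bar>g'\<bar> powr \<theta>\<close> explodes faster than \<open>g''\<close> at the boundary (lemma \<open>barrier_supersolution\<close>), and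
  the inequality for \<open>\<phi>\<close> at the maximum bounds \<open>l\<close> by a constant independent of \<open>\<phi>\<close>.
  Separability of the barrier means that only one-variable calculus along coordinate lines is
  needed.\<close>

definition admissible :: "real \<Rightarrow> ('a::euclidean_space \<Rightarrow> real) \<Rightarrow> real set" where
  "admissible \<theta> f = {l. \<exists>\<phi>. C2_function \<phi> \<and>
     (\<forall>y. - (1/2) * laplacian \<phi> y + (1/\<theta>) * norm (gradient \<phi> y) powr \<theta> \<le> f y - l)}"

lemma lambda_star_eq_Sup_admissible: "lambda_star \<theta> f = Sup (admissible \<theta> f)"
  unfolding lambda_star_def admissible_def ..

section \<open>Partial derivatives\<close>

lemma C2_function_differentiable:
  assumes "C2_function \<phi>"
  shows "\<phi> differentiable (at x)"
  using assms by (simp add: C2_function_def)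

lemma C2_function_partial_differentiable:
  assumes "C2_function \<phi>" "b \<in> Basis"
  shows "partial_derivative b \<phi> differentiable (at x)"
  using assms by (simp add: C2_function_def C1_function_def)

lemma C2_function_continuous_on: "C2_function \<phi> \<Longrightarrow> continuous_on S \<phi>"
  by (simp add: C2_function_differentiable differentiable_imp_continuous_on
      differentiable_on_def differentiable_at_withinI)

lemma partial_derivative_cmult:
  assumes "\<And>x. f differentiable (at x)"
  shows "partial_derivative b (\<lambda>x. k * f x) = (\<lambda>x. k * partial_derivative b f x)"
proof
  fix x
  have "((\<lambda>x. k * f x) has_derivative (\<lambda>h. k * frechet_derivative f (at x) h)) (at x)"
    using assms frechet_derivative_works by (intro has_derivative_mult_right) blast
  then have "frechet_derivative (\<lambda>x. k * f x) (at x) = (\<lambda>h. k * frechet_derivative f (at x) h)"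
    by (rule frechet_derivative_at[symmetric])
  then show "partial_derivative b (\<lambda>x. k * f x) x = k * partial_derivative b f x"
    by (simp add: partial_derivative_def)
qed

lemma C1_function_cmult:
  assumes "C1_function f"
  shows "C1_function (\<lambda>x. k * f x)"
  using assms unfolding C1_function_def
  by (auto simp: partial_derivative_cmult intro!: continuous_intros)

lemma C2_function_cmult:
  assumes "C2_function f"
  shows "C2_function (\<lambda>x. k * f x)"
  using assms unfolding C2_function_def
  by (auto simp: partial_derivative_cmult intro!: C1_function_cmult)

lemma gradient_cmult:
  assumes "\<And>x. f differentiable (at x)"
  shows "gradient (\<lambda>x. k * f x) x = k *\<^sub>R gradient f x"
  using assms by (simp add: gradient_def partial_derivative_cmult scaleR_sum_right)

lemma laplacian_cmult:
  assumes "C2_function f"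
  shows "laplacian (\<lambda>x. k * f x) x = k * laplacian f x"
  unfolding laplacian_def sum_distrib_left
proof (rule sum.cong[OF refl])
  fix b :: 'a assume "b \<in> Basis"
  then show "partial_derivative b (partial_derivative b (\<lambda>x. k * f x)) x =
      k * partial_derivative b (partial_derivative b f) x"
    using assms by (simp add: partial_derivative_cmult C2_function_differentiable
        C2_function_partial_differentiable)
qed

lemma partial_derivative_const: "partial_derivative b (\<lambda>x. c) = (\<lambda>x. 0)"
  by (simp add: partial_derivative_def fun_eq_iff)

lemma C2_function_const: "C2_function (\<lambda>x. c)"
  by (simp add: C2_function_def C1_function_def partial_derivative_const)

lemma abs_partial_derivative_le_norm_gradient:
  assumes "b \<in> Basis"
  shows "\<bar>partial_derivative b f x\<bar> \<le> norm (gradient f x)"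
proof -
  have "gradient f x \<bullet> b = partial_derivative b f x"
    unfolding gradient_def using assms by simp
  then show ?thesis using Basis_le_norm[OF assms, of "gradient f x"] by simp
qed

lemma has_real_derivative_along_line:
  assumes "\<phi> differentiable (at (y + t *\<^sub>R b))"
  shows "((\<lambda>t. \<phi> (y + t *\<^sub>R b)) has_real_derivative partial_derivative b \<phi> (y + t *\<^sub>R b)) (at t)"
proof -
  let ?D = "frechet_derivative \<phi> (at (y + t *\<^sub>R b))"
  have D: "(\<phi> has_derivative ?D) (at (y + t *\<^sub>R b))"
    using assms frechet_derivative_works by blast
  have "((\<lambda>t. y + t *\<^sub>R b) has_derivative (\<lambda>h. h *\<^sub>R b)) (at t)"
    by (auto intro!: derivative_eq_intros)
  then have "((\<lambda>t. \<phi> (y + t *\<^sub>R b)) has_derivative (\<lambda>h. ?D (h *\<^sub>R b))) (at t)"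
    using has_derivative_compose D by blast
  moreover have "?D (h *\<^sub>R b) = partial_derivative b \<phi> (y + t *\<^sub>R b) * h" for h
    using linear_cmul[OF has_derivative_linear[OF D]] by (simp add: partial_derivative_def)
  ultimately show ?thesis by (simp add: has_field_derivative_def)
qed

section \<open>A one-dimensional barrier\<close>

text \<open>The normalisation by \<open>2 n\<close> makes the first derivative \<open>t / (1 - t\<^sup>2) ^ (n + 1)\<close>, free of constants.\<close>

definition barrier :: "nat \<Rightarrow> real \<Rightarrow> real" where
  "barrier n t = inverse (1 - t\<^sup>2) ^ n / (2 * real n)"

definition barrier' :: "nat \<Rightarrow> real \<Rightarrow> real" where
  "barrier' n t = t * inverse (1 - t\<^sup>2) ^ (n + 1)"

definition barrier'' :: "nat \<Rightarrow> real \<Rightarrow> real" where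
  "barrier'' n t = inverse (1 - t\<^sup>2) ^ (n + 1) + 2 * (n + 1) * t\<^sup>2 * inverse (1 - t\<^sup>2) ^ (n + 2)"

lemma one_minus_square_pos: "\<bar>t\<bar> < 1 \<Longrightarrow> 0 < 1 - (t::real)\<^sup>2"
  by (simp add: abs_square_less_1)

lemma DERIV_inverse_one_minus_square_power:
  assumes "\<bar>t\<bar> < 1"
  shows "((\<lambda>t::real. inverse (1 - t\<^sup>2) ^ n) has_real_derivative
     2 * n * t * inverse (1 - t\<^sup>2) ^ (n + 1)) (at t)"
proof (cases n)
  case (Suc k)
  have "((\<lambda>t::real. inverse (1 - t\<^sup>2)) has_real_derivative 2 * t * inverse (1 - t\<^sup>2) ^ 2) (at t)"
    using one_minus_square_pos[OF assms]
    by (auto intro!: derivative_eq_intros simp: power2_eq_square)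
  from DERIV_power[OF this, of n] show ?thesis
    by (simp add: Suc power2_eq_square algebra_simps)
qed simp

lemma DERIV_barrier:
  assumes "\<bar>t\<bar> < 1" "n > 0"
  shows "(barrier n has_real_derivative barrier' n t) (at t)"
  unfolding barrier_def[abs_def] barrier'_def
  using DERIV_cdivide[OF DERIV_inverse_one_minus_square_power[OF assms(1), of n], of "2 * real n"]
    assms(2) by simp

lemma DERIV_barrier':
  assumes "\<bar>t\<bar> < 1"
  shows "(barrier' n has_real_derivative barrier'' n t) (at t)"
  unfolding barrier'_def[abs_def] barrier''_def
  using DERIV_mult[OF DERIV_ident DERIV_inverse_one_minus_square_power[OF assms, of "n + 1"]]
  by (simp add: power2_eq_square algebra_simps)

lemma barrier_nonneg: "\<bar>t\<bar> < 1 \<Longrightarrow> 0 \<le> barrier n t"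
  using one_minus_square_pos[of t] by (simp add: barrier_def)

lemma barrier_explodes:
  assumes "n > 0"
  obtains \<rho> where "0 < \<rho>" "\<rho> < 1" "\<And>t. \<rho> < \<bar>t\<bar> \<Longrightarrow> \<bar>t\<bar> < 1 \<Longrightarrow> L < barrier n t"
proof -
  \<comment> \<open>As \<open>n \<ge> 1\<close> and \<open>1 / (1 - t\<^sup>2) \<ge> 1\<close>, the barrier dominates \<open>1 / (2 n (1 - t\<^sup>2))\<close>, which exceeds
    \<open>L\<close> as soon as \<open>1 - t\<^sup>2 < 1 / K\<close>.\<close>
  define K where "K = max 2 (2 * real n * L)"
  define \<rho> where "\<rho> = sqrt (1 - 1 / K)"
  have K: "K \<ge> 2" "2 * real n * L \<le> K" by (simp_all add: K_def)
  have "0 < \<rho>" "\<rho> < 1" using K by (simp_all add: \<rho>_def field_simps)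
  moreover have "L < barrier n t" if t: "\<rho> < \<bar>t\<bar>" "\<bar>t\<bar> < 1" for t
  proof -
    have "\<rho>\<^sup>2 < t\<^sup>2" using t \<open>0 < \<rho>\<close> power2_strict_mono[of \<rho> t] by simp
    moreover have "\<rho>\<^sup>2 = 1 - 1 / K" using K by (simp add: \<rho>_def)
    ultimately have "1 - t\<^sup>2 < 1 / K" by simp
    moreover have s: "0 < 1 - t\<^sup>2" using one_minus_square_pos t by blast
    ultimately have "K < inverse (1 - t\<^sup>2)" using K by (simp add: field_simps)
    moreover have "inverse (1 - t\<^sup>2) \<le> inverse (1 - t\<^sup>2) ^ n"
      using self_le_power[of "inverse (1 - t\<^sup>2)" n] s assms by (simp add: one_le_inverse)
    ultimately have "2 * real n * L < inverse (1 - t\<^sup>2) ^ n" using K by linarith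
    then show ?thesis using assms by (simp add: barrier_def pos_less_divide_eq mult_ac)
  qed
  ultimately show thesis by (rule that)
qed

text \<open>With \<open>r = 1 / (1 - t\<^sup>2)\<close>, near the boundary \<open>\<bar>g'\<bar> powr \<theta>\<close> is of order \<open>r powr (\<theta> (n + 1))\<close>
  and \<open>g''\<close> of order \<open>r powr (n + 2)\<close>. The former wins once \<open>\<theta> (n + 1) > n + 2\<close>, which holds
  for large \<open>n\<close> because \<open>\<theta> > 1\<close>.\<close>

lemma barrier_supersolution:
  assumes "\<theta> > 1" "a > 0"
  obtains n C where "n > 0"
    "\<And>t. \<bar>t\<bar> < 1 \<Longrightarrow> - C \<le> a * \<bar>barrier' n t\<bar> powr \<theta> - (1/2) * barrier'' n t"
proof -
  obtain n0 :: nat where "1 / (\<theta> - 1) < real n0" using reals_Archimedean2 by blast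
  define n where "n = Suc n0"
  have "1 / (\<theta> - 1) < real n + 1" using \<open>1 / (\<theta> - 1) < real n0\<close> by (simp add: n_def)
  then have n: "n > 0" "1 < (real n + 1) * (\<theta> - 1)"
    using assms by (simp_all add: n_def field_simps)
  define \<delta> where "\<delta> = \<theta> * (real n + 1) - (real n + 2)"
  have \<delta>: "\<delta> > 0" using n by (simp add: \<delta>_def algebra_simps)
  define a' where "a' = a * (1/2) powr \<theta>"
  define b where "b = real n + 2"
  have a': "a' > 0" and b: "b > 0" using assms by (simp_all add: a'_def b_def)
  \<comment> \<open>Beyond \<open>r0\<close> the gradient term alone absorbs \<open>g''\<close>; up to \<open>r0\<close> the second derivative is
    bounded. The lower limit \<open>2\<close> for \<open>r0\<close> keeps \<open>\<bar>t\<bar>\<close> away from \<open>0\<close> beyond \<open>r0\<close>.\<close>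
  define r0 where "r0 = max 2 ((b / a') powr (1 / \<delta>))"
  define C where "C = b * r0 ^ (n + 2)"
  have "- C \<le> a * \<bar>barrier' n t\<bar> powr \<theta> - (1/2) * barrier'' n t" if t: "\<bar>t\<bar> < 1" for t
  proof -
    define r where "r = inverse (1 - t\<^sup>2)"
    have s: "0 < 1 - t\<^sup>2" using one_minus_square_pos t by blast
    have r1: "1 \<le> r" using s by (simp add: r_def one_le_inverse)
    have "t\<^sup>2 \<le> 1" using s by simp
    then have "t\<^sup>2 * r ^ (n + 2) \<le> r ^ (n + 2)"
      using r1 by (intro mult_left_le_one_le) auto
    then have "(real n + 1) * (t\<^sup>2 * r ^ (n + 2)) \<le> (real n + 1) * r ^ (n + 2)"
      by (intro mult_left_mono) auto
    moreover have "r ^ (n + 1) \<le> r ^ (n + 2)" using r1 by (intro power_increasing) auto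
    moreover have "0 \<le> r ^ (n + 2)" using r1 by simp
    ultimately have g2: "(1/2) * barrier'' n t \<le> b * r ^ (n + 2)"
      by (simp add: barrier''_def b_def r_def[symmetric] algebra_simps)
    show ?thesis
    proof (cases "r \<le> r0")
      case True
      then have "r ^ (n + 2) \<le> r0 ^ (n + 2)" using r1 by (intro power_mono) auto
      then have "b * r ^ (n + 2) \<le> C" using b by (simp add: C_def)
      moreover have "0 \<le> a * \<bar>barrier' n t\<bar> powr \<theta>" using assms by simp
      ultimately show ?thesis using g2 by linarith
    next
      case False
      then have r: "2 < r" "(b / a') powr (1 / \<delta>) < r" by (auto simp: r0_def)
      have "1 - t\<^sup>2 < 1/2" using r(1) s by (simp add: r_def field_simps)
      then have "(1/2)\<^sup>2 \<le> t\<^sup>2" by (simp add: power2_eq_square)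
      then have "1/2 \<le> \<bar>t\<bar>" using abs_le_square_iff[of "1/2" t] by simp
      then have "(1/2) * r ^ (n + 1) \<le> \<bar>barrier' n t\<bar>"
        using r1 by (simp add: barrier'_def r_def[symmetric] abs_mult)
      then have "((1/2) * r ^ (n + 1)) powr \<theta> \<le> \<bar>barrier' n t\<bar> powr \<theta>"
        using assms r1 by (intro powr_mono2) auto
      moreover have "((1/2) * r ^ (n + 1)) powr \<theta> = (1/2) powr \<theta> * r powr (\<theta> * (real n + 1))"
      proof -
        have "r ^ (n + 1) = r powr (real n + 1)"
          using r1 powr_realpow[of r "n + 1"] by (simp add: add.commute)
        moreover have "((1/2) * r powr (real n + 1)) powr \<theta> = (1/2) powr \<theta> * r powr (\<theta> * (real n + 1))"
          by (subst powr_mult) (auto simp: powr_powr mult.commute)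
        ultimately show ?thesis by simp
      qed
      ultimately have "a' * r powr (\<theta> * (real n + 1)) \<le> a * \<bar>barrier' n t\<bar> powr \<theta>"
        using assms by (simp add: a'_def)
      moreover have "r powr (\<theta> * (real n + 1)) = r powr \<delta> * r ^ (n + 2)"
      proof -
        have "r ^ (n + 2) = r powr (real n + 2)"
          using r1 powr_realpow[of r "n + 2"] by (simp add: add.commute)
        then show ?thesis by (simp add: \<delta>_def flip: powr_add)
      qed
      moreover have "b \<le> a' * r powr \<delta>"
      proof -
        have "((b / a') powr (1 / \<delta>)) powr \<delta> \<le> r powr \<delta>"
          using r \<delta> by (intro powr_mono2) auto
        then show ?thesis using a' b \<delta> by (simp add: powr_powr field_simps)
      qed
      then have "b * r ^ (n + 2) \<le> a' * r powr \<delta> * r ^ (n + 2)"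
        using r1 by (intro mult_right_mono) auto
      ultimately have "b * r ^ (n + 2) \<le> a * \<bar>barrier' n t\<bar> powr \<theta>"
        by (simp add: mult.assoc)
      moreover have "0 \<le> C" using b by (simp add: C_def r0_def)
      ultimately show ?thesis using g2 by linarith
    qed
  qed
  with n(1) show thesis by (rule that)
qed

section \<open>Boundedness of the admissible levels\<close>

lemma local_max_second_derivative_nonpos:
  fixes h h' :: "real \<Rightarrow> real"
  assumes "e > 0"
    and h: "\<And>t. \<bar>t\<bar> < e \<Longrightarrow> (h has_real_derivative h' t) (at t)"
    and h': "(h' has_real_derivative D) (at 0)"
    and max: "\<And>t. \<bar>t\<bar> < e \<Longrightarrow> h t \<le> h 0"
  shows "h' 0 = 0" "D \<le> 0"
proof -
  show h'0: "h' 0 = 0"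
    using DERIV_local_max[OF h[of 0] \<open>e > 0\<close>] max \<open>e > 0\<close> by simp
  show "D \<le> 0"
  proof (rule ccontr)
    assume "\<not> D \<le> 0"
    then obtain d where d: "d > 0" "\<And>t. 0 < t \<Longrightarrow> t < d \<Longrightarrow> 0 < h' t"
      using DERIV_pos_inc_right[OF h'] h'0 by auto
    define t where "t = min d e / 2"
    have t: "0 < t" "t < d" "t < e" using d(1) \<open>e > 0\<close> by (auto simp: t_def)
    \<comment> \<open>The mean value theorem avoids the endpoint \<open>0\<close>, where \<open>h'\<close> vanishes.\<close>
    obtain z where "0 < z" "z < t" "h t - h 0 = (t - 0) * h' z"
      using MVT2[of 0 t h h'] t h by auto
    then have "h 0 < h t" using d(2)[of z] t by (simp add: zero_less_mult_iff algebra_simps)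
    then show False using max[of t] t by simp
  qed
qed

lemma subtract_barrier_attains_max:
  fixes \<phi> :: "'a::euclidean_space \<Rightarrow> real"
  assumes "continuous_on UNIV \<phi>" "n > 0"
  obtains x where "\<And>b. b \<in> Basis \<Longrightarrow> \<bar>x \<bullet> b\<bar> < 1"
    and "\<And>y. (\<And>b. b \<in> Basis \<Longrightarrow> \<bar>y \<bullet> b\<bar> < 1) \<Longrightarrow>
       \<phi> y - (\<Sum>b\<in>Basis. barrier n (y \<bullet> b)) \<le> \<phi> x - (\<Sum>b\<in>Basis. barrier n (x \<bullet> b))"
proof -
  let ?F = "\<lambda>y. \<phi> y - (\<Sum>b\<in>Basis. barrier n (y \<bullet> b))"
  have "compact (\<phi> ` cbox (- One) One)"
    using assms(1) by (intro compact_continuous_image compact_cbox) (rule continuous_on_subset, auto)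
  then have "bdd_above (\<phi> ` cbox (- One) One)"
    by (simp add: bounded_imp_bdd_above compact_imp_bounded)
  then obtain M where M: "\<And>y. y \<in> cbox (- One) One \<Longrightarrow> \<phi> y \<le> M"
    unfolding bdd_above_def by auto
  \<comment> \<open>Outside the cube of half-width \<open>\<rho>\<close> the function is smaller than its value at the origin.\<close>
  obtain \<rho> where \<rho>: "0 < \<rho>" "\<rho> < 1" "\<And>t. \<rho> < \<bar>t\<bar> \<Longrightarrow> \<bar>t\<bar> < 1 \<Longrightarrow> M - ?F 0 < barrier n t"
    using barrier_explodes[OF assms(2)] by blast
  let ?K = "cbox (- (\<rho> *\<^sub>R One)) (\<rho> *\<^sub>R One) :: 'a set"
  have inK: "y \<in> ?K \<longleftrightarrow> (\<forall>b\<in>Basis. \<bar>y \<bullet> b\<bar> \<le> \<rho>)" for y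
  proof -
    have "- \<rho> \<le> y \<bullet> b \<and> y \<bullet> b \<le> \<rho> \<longleftrightarrow> \<bar>y \<bullet> b\<bar> \<le> \<rho>" for b by linarith
    then show ?thesis by (simp add: mem_box)
  qed
  have "continuous_on ?K ?F"
  proof (intro continuous_on_diff continuous_on_sum)
    show "continuous_on ?K \<phi>" using assms(1) continuous_on_subset by blast
    fix b :: 'a assume b: "b \<in> Basis"
    have "continuous_on {- \<rho>..\<rho>} (barrier n)"
      using \<rho>(2) assms(2)
      by (intro DERIV_continuous_on[where D = "barrier' n"] has_field_derivative_at_within[OF DERIV_barrier])
        auto
    moreover have "continuous_on ?K (\<lambda>y. y \<bullet> b)" by (intro continuous_intros)
    moreover have "(\<lambda>y. y \<bullet> b) ` ?K \<subseteq> {- \<rho>..\<rho>}"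
    proof (rule image_subsetI)
      fix y assume "y \<in> ?K"
      then have "\<bar>y \<bullet> b\<bar> \<le> \<rho>" using inK b by blast
      then show "y \<bullet> b \<in> {- \<rho>..\<rho>}" by auto
    qed
    ultimately show "continuous_on ?K (\<lambda>y. barrier n (y \<bullet> b))"
      by (rule continuous_on_compose2)
  qed
  moreover have 0: "0 \<in> ?K" unfolding inK using \<rho>(1) by simp
  ultimately obtain x where x: "x \<in> ?K" "\<And>y. y \<in> ?K \<Longrightarrow> ?F y \<le> ?F x"
    using continuous_attains_sup[OF compact_cbox, of "- (\<rho> *\<^sub>R One)" "\<rho> *\<^sub>R One" ?F] by blast
  have "?F y \<le> ?F x" if y: "\<And>b. b \<in> Basis \<Longrightarrow> \<bar>y \<bullet> b\<bar> < 1" for y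
  proof (cases "y \<in> ?K")
    case False
    then obtain b where b: "b \<in> Basis" "\<rho> < \<bar>y \<bullet> b\<bar>" unfolding inK using not_le by blast
    have "- 1 \<le> y \<bullet> b \<and> y \<bullet> b \<le> 1" if "b \<in> Basis" for b using y[OF that] by linarith
    then have "y \<in> cbox (- One) One" by (auto simp: mem_box)
    then have "\<phi> y \<le> M" by (rule M)
    moreover have "barrier n (y \<bullet> b) \<le> (\<Sum>b\<in>Basis. barrier n (y \<bullet> b))"
      using b(1) y by (intro member_le_sum) (auto intro!: barrier_nonneg)
    moreover have "M - ?F 0 < barrier n (y \<bullet> b)" using \<rho>(3) b y by blast
    ultimately have "?F y \<le> ?F 0" by linarith
    also have "\<dots> \<le> ?F x" using x(2) 0 by blast
    finally show ?thesis .
  qed (rule x(2))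
  moreover have "\<bar>x \<bullet> b\<bar> < 1" if "b \<in> Basis" for b
    using bspec[OF iffD1[OF inK x(1)] that] \<rho>(2) by linarith
  ultimately show thesis by (metis that)
qed

lemma bdd_above_admissible:
  fixes f :: "'a::euclidean_space \<Rightarrow> real"
  assumes "\<theta> > 1"
    and f: "\<And>y. (\<And>b. b \<in> Basis \<Longrightarrow> \<bar>y \<bullet> b\<bar> < 1) \<Longrightarrow> f y \<le> B"
  shows "bdd_above (admissible \<theta> f)"
proof -
  let ?d = "real DIM('a)"
  have d: "?d > 0" by simp
  \<comment> \<open>The factor \<open>1 / d\<close> shares \<open>\<bar>D \<phi>\<bar> powr \<theta>\<close> equally among the coordinate directions.\<close>
  define a where "a = 1 / (?d * \<theta>)"
  have "a > 0" using assms d by (simp add: a_def)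
  then obtain n C where n: "n > 0" and
    C: "\<And>t. \<bar>t\<bar> < 1 \<Longrightarrow> - C \<le> a * \<bar>barrier' n t\<bar> powr \<theta> - (1/2) * barrier'' n t"
    using barrier_supersolution[OF assms(1)] by blast
  have "l \<le> B + ?d * C" if l: "l \<in> admissible \<theta> f" for l
  proof -
    obtain \<phi> where \<phi>: "C2_function \<phi>"
      and sub: "\<And>y. - (1/2) * laplacian \<phi> y + (1/\<theta>) * norm (gradient \<phi> y) powr \<theta> \<le> f y - l"
      using l unfolding admissible_def by blast
    obtain x where x: "\<And>b. b \<in> Basis \<Longrightarrow> \<bar>x \<bullet> b\<bar> < 1"
      and max: "\<And>y. (\<And>b. b \<in> Basis \<Longrightarrow> \<bar>y \<bullet> b\<bar> < 1) \<Longrightarrow>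
       \<phi> y - (\<Sum>b\<in>Basis. barrier n (y \<bullet> b)) \<le> \<phi> x - (\<Sum>b\<in>Basis. barrier n (x \<bullet> b))"
      using subtract_barrier_attains_max[OF C2_function_continuous_on[OF \<phi>] n] by blast
    have deriv: "partial_derivative b \<phi> x = barrier' n (x \<bullet> b)"
        "partial_derivative b (partial_derivative b \<phi>) x \<le> barrier'' n (x \<bullet> b)"
      if b: "b \<in> Basis" for b
    proof -
      define e where "e = 1 - \<bar>x \<bullet> b\<bar>"
      have e: "e > 0" using x[OF b] by (simp add: e_def)
      have small: "\<bar>x \<bullet> b + t\<bar> < 1" if "\<bar>t\<bar> < e" for t using that by (simp add: e_def)
      define h where "h = (\<lambda>t. \<phi> (x + t *\<^sub>R b) - barrier n (x \<bullet> b + t))"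
      define h' where "h' = (\<lambda>t. partial_derivative b \<phi> (x + t *\<^sub>R b) - barrier' n (x \<bullet> b + t))"
      have h: "(h has_real_derivative h' t) (at t)" if "\<bar>t\<bar> < e" for t
        unfolding h_def h'_def
      proof (rule DERIV_diff)
        show "((\<lambda>t. barrier n (x \<bullet> b + t)) has_real_derivative barrier' n (x \<bullet> b + t)) (at t)"
          using DERIV_barrier[OF small[OF that] n] by (simp add: DERIV_shift add.commute)
      qed (intro has_real_derivative_along_line C2_function_differentiable \<phi>)
      have h': "(h' has_real_derivative
          partial_derivative b (partial_derivative b \<phi>) x - barrier'' n (x \<bullet> b)) (at 0)"
        unfolding h'_def
      proof (rule DERIV_diff)
        show "((\<lambda>t. barrier' n (x \<bullet> b + t)) has_real_derivative barrier'' n (x \<bullet> b)) (at 0)"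
          using DERIV_barrier'[OF x[OF b], of n] DERIV_shift[of "barrier' n" "barrier'' n (x \<bullet> b)" 0 "x \<bullet> b"]
          by (simp add: add.commute)
        show "((\<lambda>t. partial_derivative b \<phi> (x + t *\<^sub>R b)) has_real_derivative
            partial_derivative b (partial_derivative b \<phi>) x) (at 0)"
          using has_real_derivative_along_line[of "partial_derivative b \<phi>" x 0 b]
            C2_function_partial_differentiable[OF \<phi> b] by simp
      qed
      have "h t \<le> h 0" if t: "\<bar>t\<bar> < e" for t
      proof -
        let ?y = "x + t *\<^sub>R b"
        have y: "?y \<bullet> c = x \<bullet> c + (if c = b then t else 0)" if "c \<in> Basis" for c
          using b that by (simp add: inner_add_left inner_Basis)
        have "\<bar>?y \<bullet> c\<bar> < 1" if "c \<in> Basis" for c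
          using x[OF that] small[OF t] y[OF that] by auto
        then have "\<phi> ?y - (\<Sum>c\<in>Basis. barrier n (?y \<bullet> c)) \<le> \<phi> x - (\<Sum>c\<in>Basis. barrier n (x \<bullet> c))"
          by (rule max)
        \<comment> \<open>All summands except the one in direction \<open>b\<close> cancel.\<close>
        moreover have "(\<Sum>c\<in>Basis - {b}. barrier n (?y \<bullet> c)) = (\<Sum>c\<in>Basis - {b}. barrier n (x \<bullet> c))"
          using y by (intro sum.cong) auto
        ultimately show ?thesis
          using y[OF b] by (simp add: h_def sum.remove[OF finite_Basis b])
      qed
      from local_max_second_derivative_nonpos[OF e h h' this]
      show "partial_derivative b \<phi> x = barrier' n (x \<bullet> b)"
        "partial_derivative b (partial_derivative b \<phi>) x \<le> barrier'' n (x \<bullet> b)"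
        by (simp_all add: h'_def)
    qed
    have "(\<Sum>b\<in>Basis. a * \<bar>barrier' n (x \<bullet> b)\<bar> powr \<theta>)
        \<le> (\<Sum>b\<in>(Basis::'a set). a * norm (gradient \<phi> x) powr \<theta>)"
    proof (rule sum_mono)
      fix b :: 'a assume b: "b \<in> Basis"
      have "\<bar>barrier' n (x \<bullet> b)\<bar> \<le> norm (gradient \<phi> x)"
        using abs_partial_derivative_le_norm_gradient[OF b, of \<phi> x] deriv(1)[OF b] by simp
      then show "a * \<bar>barrier' n (x \<bullet> b)\<bar> powr \<theta> \<le> a * norm (gradient \<phi> x) powr \<theta>"
        using \<open>a > 0\<close> assms(1) by (intro mult_left_mono powr_mono2) auto
    qed
    also have "\<dots> = (1/\<theta>) * norm (gradient \<phi> x) powr \<theta>"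
      using d by (simp add: a_def)
    finally have grad: "(\<Sum>b\<in>Basis. a * \<bar>barrier' n (x \<bullet> b)\<bar> powr \<theta>)
        \<le> (1/\<theta>) * norm (gradient \<phi> x) powr \<theta>" .
    have lap: "laplacian \<phi> x \<le> (\<Sum>b\<in>Basis. barrier'' n (x \<bullet> b))"
      unfolding laplacian_def by (intro sum_mono deriv)
    have "- (?d * C) = (\<Sum>b\<in>(Basis::'a set). - C)" by simp
    also have "\<dots> \<le> (\<Sum>b\<in>Basis. a * \<bar>barrier' n (x \<bullet> b)\<bar> powr \<theta> - (1/2) * barrier'' n (x \<bullet> b))"
      by (intro sum_mono C x)
    also have "\<dots> = (\<Sum>b\<in>Basis. a * \<bar>barrier' n (x \<bullet> b)\<bar> powr \<theta>)
        - (1/2) * (\<Sum>b\<in>Basis. barrier'' n (x \<bullet> b))"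
      by (simp add: sum_subtractf sum_distrib_left)
    finally show "l \<le> B + ?d * C" using grad lap sub[of x] f[OF x] by linarith
  qed
  then show ?thesis by (rule bdd_aboveI)
qed

section \<open>Comparison of the critical values\<close>

lemma H1_bdd_above_admissible:
  fixes f :: "'a::euclidean_space \<Rightarrow> real"
  assumes "\<theta> > 1" "\<alpha> \<ge> 1" "f\<^sub>0 > 0" "H1 \<alpha> f\<^sub>0 f"
  shows "bdd_above (admissible \<theta> f)"
proof (rule bdd_above_admissible[OF assms(1)])
  fix y :: 'a assume y: "\<And>b. b \<in> Basis \<Longrightarrow> \<bar>y \<bullet> b\<bar> < 1"
  have "norm y \<le> (\<Sum>b\<in>Basis. \<bar>y \<bullet> b\<bar>)" by (rule norm_le_l1)
  also have "\<dots> \<le> (\<Sum>b\<in>(Basis::'a set). 1)" by (intro sum_mono less_imp_le y)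
  finally have "norm y powr \<alpha> \<le> real DIM('a) powr \<alpha>"
    using assms by (intro powr_mono2) auto
  then have "f\<^sub>0 * (norm y powr \<alpha> + 1) \<le> f\<^sub>0 * (real DIM('a) powr \<alpha> + 1)"
    using assms by simp
  then show "f y \<le> f\<^sub>0 * (real DIM('a) powr \<alpha> + 1)"
    using assms(4) unfolding H1_def by (meson order_trans)
qed

text \<open>Constants are subsolutions at the level of any lower bound.\<close>

lemma admissible_nonempty:
  assumes "bdd_below (range f)"
  shows "admissible \<theta> f \<noteq> {}"
proof -
  obtain c where "\<And>y. c \<le> f y" using assms unfolding bdd_below_def by auto
  then have "c \<in> admissible \<theta> f"
    unfolding admissible_def mem_Collect_eq
    by (intro exI[of _ "\<lambda>_. 0"])
      (simp add: C2_function_const laplacian_def gradient_def partial_derivative_const)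
  then show ?thesis by blast
qed

text \<open>Multiplying a subsolution by \<open>k \<le> 1\<close> scales the Laplacian by \<open>k\<close> but the gradient term by
  the smaller factor \<open>k powr \<theta>\<close>.\<close>

lemma admissible_scaled:
  assumes "\<theta> > 1" "0 < k" "k \<le> 1" and f: "\<And>y. k * g y \<le> f y"
    and "l \<in> admissible \<theta> g"
  shows "k * l \<in> admissible \<theta> f"
proof -
  obtain \<phi> where \<phi>: "C2_function \<phi>"
    and sub: "\<And>y. - (1/2) * laplacian \<phi> y + (1/\<theta>) * norm (gradient \<phi> y) powr \<theta> \<le> g y - l"
    using assms(5) unfolding admissible_def by blast
  have "- (1/2) * laplacian (\<lambda>x. k * \<phi> x) y + (1/\<theta>) * norm (gradient (\<lambda>x. k * \<phi> x) y) powr \<theta>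
      \<le> f y - k * l" for y
  proof -
    have "k powr \<theta> \<le> k powr 1" using assms by (intro powr_mono') auto
    then have "k powr \<theta> * norm (gradient \<phi> y) powr \<theta> \<le> k * norm (gradient \<phi> y) powr \<theta>"
      using assms(2) by (intro mult_right_mono) auto
    then have "norm (gradient (\<lambda>x. k * \<phi> x) y) powr \<theta> \<le> k * norm (gradient \<phi> y) powr \<theta>"
      using assms(2) by (simp add: gradient_cmult C2_function_differentiable[OF \<phi>] powr_mult)
    then have "(1/\<theta>) * norm (gradient (\<lambda>x. k * \<phi> x) y) powr \<theta>
        \<le> (1/\<theta>) * (k * norm (gradient \<phi> y) powr \<theta>)"
      using assms(1) by (intro mult_left_mono) auto
    then have "- (1/2) * laplacian (\<lambda>x. k * \<phi> x) y + (1/\<theta>) * norm (gradient (\<lambda>x. k * \<phi> x) y) powr \<theta>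
        \<le> k * (- (1/2) * laplacian \<phi> y + (1/\<theta>) * norm (gradient \<phi> y) powr \<theta>)"
      by (simp add: laplacian_cmult[OF \<phi>] algebra_simps)
    also have "\<dots> \<le> k * (g y - l)" using sub[of y] assms(2) by (intro mult_left_mono) auto
    also have "\<dots> \<le> f y - k * l" using f[of y] by (simp add: algebra_simps)
    finally show ?thesis .
  qed
  then show ?thesis
    unfolding admissible_def using C2_function_cmult[OF \<phi>] by blast
qed

lemma lambda_star_scaling:
  assumes "\<theta> > 1" "0 < k" "k \<le> 1" "\<And>y. k * g y \<le> f y"
    and "admissible \<theta> g \<noteq> {}" "bdd_above (admissible \<theta> f)"
  shows "k * lambda_star \<theta> g \<le> lambda_star \<theta> f"
proof -
  have "lambda_star \<theta> g \<le> lambda_star \<theta> f / k"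
    unfolding lambda_star_eq_Sup_admissible
  proof (rule cSup_least[OF assms(5)])
    fix l assume "l \<in> admissible \<theta> g"
    then have "k * l \<le> Sup (admissible \<theta> f)"
      using admissible_scaled[OF assms(1-4)] assms(6) by (intro cSup_upper)
    then show "l \<le> Sup (admissible \<theta> f) / k" using assms(2) by (simp add: field_simps)
  qed
  then show ?thesis using assms(2) by (simp add: field_simps)
qed

text \<open>This is the one-sided half of the estimate; the hypothesis on \<open>f - g\<close> is symmetric in
  \<open>f\<close> and \<open>g\<close>, so that the two halves follow by exchanging them.\<close>

lemma lambda_star_diff_le:
  fixes f g :: "'a::euclidean_space \<Rightarrow> real"
  assumes "\<theta> > 1" "\<alpha> \<ge> 1" "f\<^sub>0 > 0" "H1 \<alpha> f\<^sub>0 f" "H0 \<alpha> f\<^sub>0 g"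
    and "0 \<le> m" and fg: "\<And>y. \<bar>f y - g y\<bar> \<le> m * (1 + norm y powr \<alpha>)"
  shows "lambda_star \<theta> g - lambda_star \<theta> f \<le> f\<^sub>0 * m / (1 + f\<^sub>0 * m) * lambda_star \<theta> g"
proof -
  define c where "c = f\<^sub>0 * m"
  have c: "0 \<le> c" using assms by (simp add: c_def)
  have "1 / (1 + c) * g y \<le> f y" for y
  proof -
    have "inverse f\<^sub>0 * (norm y powr \<alpha> + 1) \<le> f y" using assms(4) by (simp add: H1_def)
    then have "1 + norm y powr \<alpha> \<le> f\<^sub>0 * f y" using assms(3) by (simp add: field_simps)
    from mult_left_mono[OF this assms(6)] have "m * (1 + norm y powr \<alpha>) \<le> c * f y"
      by (simp add: c_def mult.assoc mult.left_commute)
    then have "g y \<le> (1 + c) * f y" using fg[of y] by (simp add: algebra_simps abs_le_iff)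
    then show ?thesis using c by (simp add: field_simps)
  qed
  then have "1 / (1 + c) * lambda_star \<theta> g \<le> lambda_star \<theta> f"
    using assms c
    by (intro lambda_star_scaling H1_bdd_above_admissible[of \<theta> \<alpha> f\<^sub>0] admissible_nonempty)
      (auto simp: H0_def)
  moreover have "1 / (1 + c) = 1 - c / (1 + c)" using c by (simp add: field_simps)
  ultimately show ?thesis unfolding c_def[symmetric] by (simp add: left_diff_distrib)
qed

theorem proposition4p4:
  fixes f\<^sub>1 f\<^sub>2 :: "'a::euclidean_space \<Rightarrow> real" and \<theta> \<alpha> f\<^sub>0 m :: real
  assumes "\<theta> > 1" and "\<alpha> \<ge> 1" and "f\<^sub>0 > 0"
    and "H0 \<alpha> f\<^sub>0 f\<^sub>1" and "H1 \<alpha> f\<^sub>0 f\<^sub>1"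
    and "H0 \<alpha> f\<^sub>0 f\<^sub>2" and "H1 \<alpha> f\<^sub>0 f\<^sub>2"
    and "m = (SUP y. \<bar>f\<^sub>1 y - f\<^sub>2 y\<bar> / (1 + norm y powr \<alpha>))"
  shows "\<bar>lambda_star \<theta> f\<^sub>2 - lambda_star \<theta> f\<^sub>1\<bar>
    \<le> f\<^sub>0 * m / (1 + f\<^sub>0 * m) * max (lambda_star \<theta> f\<^sub>1) (lambda_star \<theta> f\<^sub>2)"
proof -
  let ?q = "\<lambda>y. \<bar>f\<^sub>1 y - f\<^sub>2 y\<bar> / (1 + norm y powr \<alpha>)"
  have w: "0 < 1 + norm y powr \<alpha>" for y :: 'a by (simp add: add_pos_nonneg)
  \<comment> \<open>By \<open>H1\<close> both functions lie in \<open>[0, f\<^sub>0 (1 + \<bar>y\<bar>\<^sup>\<alpha>)]\<close>, so the supremum \<open>m\<close> is a true one.\<close>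
  have "?q y \<le> f\<^sub>0" for y
  proof -
    have "0 \<le> inverse f\<^sub>0 * (norm y powr \<alpha> + 1)" using assms(3) by simp
    then have "\<bar>f\<^sub>1 y - f\<^sub>2 y\<bar> \<le> f\<^sub>0 * (norm y powr \<alpha> + 1)"
      using assms(5,7) unfolding H1_def by (smt (verit))
    then show ?thesis using w[of y] by (simp add: field_simps)
  qed
  then have bdd: "bdd_above (range ?q)" by (intro bdd_aboveI) auto
  have q: "?q y \<le> m" for y
    unfolding assms(8) by (rule cSUP_upper[OF UNIV_I bdd])
  have "0 \<le> ?q 0" by simp
  then have m: "0 \<le> m" using q[of 0] by linarith
  have le: "\<bar>f\<^sub>1 y - f\<^sub>2 y\<bar> \<le> m * (1 + norm y powr \<alpha>)" for y
    using q[of y] w[of y] by (simp add: pos_divide_le_eq)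
  let ?c = "f\<^sub>0 * m / (1 + f\<^sub>0 * m)"
  have "lambda_star \<theta> f\<^sub>2 - lambda_star \<theta> f\<^sub>1 \<le> ?c * lambda_star \<theta> f\<^sub>2"
    using assms m le by (intro lambda_star_diff_le) auto
  moreover have "lambda_star \<theta> f\<^sub>1 - lambda_star \<theta> f\<^sub>2 \<le> ?c * lambda_star \<theta> f\<^sub>1"
    using assms m le by (intro lambda_star_diff_le) (auto simp: abs_minus_commute)
  moreover have "0 \<le> ?c" using m assms(3) by simp
  then have "?c * lambda_star \<theta> f\<^sub>2 \<le> ?c * max (lambda_star \<theta> f\<^sub>1) (lambda_star \<theta> f\<^sub>2)"
    "?c * lambda_star \<theta> f\<^sub>1 \<le> ?c * max (lambda_star \<theta> f\<^sub>1) (lambda_star \<theta> f\<^sub>2)"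
    by (intro mult_left_mono; simp)+
  ultimately show ?thesis by linarith
qed

end
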